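(* Let $X$ be a zero-dimensional Hausdorff space and let $A_c(X)$ be a ring with $C_c^*(X)\subseteq A_c(X)\subseteq C_c(X)$. If $A_c(X)$ is von Neumann regular, then $A_c(X)=C_c(X)$.
   Context: A space is zero-dimensional if its clopen sets form a base for its topology. $C_c(X)$ is the ring of real-valued continuous functions on $X$ with countable range, and $C_c^*(X)$ is the subring of bounded members of $C_c(X)$. *)

theory Defs
  imports "HOL-Analysis.Analysis" "HOL-Algebra.Subrings"
begin

text \<open>\<open>openin X = arbitrary union_of P\<close> is the library's way of saying that
  the sets satisfying \<open>P\<close> form a base of \<open>X\<close>.\<close>

definition zero_dimensional_space :: "'a topology \<Rightarrow> bool" where
  "zero_dimensional_space X \<longleftrightarrow>
     openin X = arbitrary union_of (\<lambda>U. openin X U \<and> closedin X U)"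

text \<open>A real-valued function on the space \<open>X\<close> is represented by its unique
  extensional representative, which is \<open>undefined\<close> outside \<open>topspace X\<close>; thus equality of
  functions on \<open>X\<close> is equality in HOL.\<close>

definition Cc :: "'a topology \<Rightarrow> ('a \<Rightarrow> real) set" where
  "Cc X = {f \<in> extensional (topspace X).
             continuous_map X euclideanreal f \<and> countable (f ` topspace X)}"

definition Cc_star :: "'a topology \<Rightarrow> ('a \<Rightarrow> real) set" where
  "Cc_star X = {f \<in> Cc X. bounded (f ` topspace X)}"

definition Cc_ring :: "'a topology \<Rightarrow> ('a \<Rightarrow> real) ring" where
  "Cc_ring X =
     \<lparr>carrier = Cc X,
      monoid.mult = (\<lambda>f g. \<lambda>x\<in>topspace X. f x * g x),
      one = (\<lambda>x\<in>topspace X. 1),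
      zero = (\<lambda>x\<in>topspace X. 0),
      add = (\<lambda>f g. \<lambda>x\<in>topspace X. f x + g x)\<rparr>"

definition von_neumann_regular :: "('a, 'b) ring_scheme \<Rightarrow> bool" where
  "von_neumann_regular R \<longleftrightarrow>
     ring R \<and> (\<forall>a\<in>carrier R. \<exists>x\<in>carrier R. a = a \<otimes>\<^bsub>R\<^esub> x \<otimes>\<^bsub>R\<^esub> a)"

lemma Cc_restrict_iff:
  "restrict f (topspace X) \<in> Cc X \<longleftrightarrow>
     continuous_map X euclideanreal f \<and> countable (f ` topspace X)"
proof -
  have "continuous_map X euclideanreal (restrict f (topspace X))
        \<longleftrightarrow> continuous_map X euclideanreal f"
    using continuous_map_eq[of X euclideanreal f "restrict f (topspace X)"]
      continuous_map_eq[of X euclideanreal "restrict f (topspace X)" f] by auto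
  then show ?thesis by (simp add: Cc_def)
qed

lemma countable_image_binop:
  assumes "countable (f ` S)" "countable (g ` S)"
  shows "countable ((\<lambda>x. h (f x) (g x)) ` S)"
proof -
  have "(\<lambda>x. h (f x) (g x)) ` S \<subseteq> (\<lambda>(a, b). h a b) ` (f ` S \<times> g ` S)" by auto
  then show ?thesis using assms by (meson countable_SIGMA countable_image countable_subset)
qed

lemma Cc_closed:
  assumes "f \<in> Cc X" "g \<in> Cc X"
  shows "(\<lambda>x\<in>topspace X. f x + g x) \<in> Cc X"
    and "(\<lambda>x\<in>topspace X. f x * g x) \<in> Cc X"
    and "(\<lambda>x\<in>topspace X. - f x) \<in> Cc X"
  using assms countable_image_binop[of f "topspace X" g "(+)"]
    countable_image_binop[of f "topspace X" g "(*)"]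
    countable_image_binop[of f "topspace X" f "\<lambda>a b. - a"]
  unfolding Cc_restrict_iff
  by (auto simp: Cc_def intro!: continuous_intros continuous_map_add continuous_map_real_mult
      continuous_map_minus)

lemma Cc_const: "(\<lambda>x\<in>topspace X. c) \<in> Cc X"
  unfolding Cc_restrict_iff by (auto intro: countable_subset[of _ "{c}"])

lemma cring_Cc_ring: "cring (Cc_ring X)"
proof (rule cringI)
  have ext: "f \<in> extensional (topspace X)" if "f \<in> Cc X" for f
    using that by (simp add: Cc_def)
  show "abelian_group (Cc_ring X)"
  proof (rule abelian_groupI)
    fix f assume "f \<in> carrier (Cc_ring X)"
    then have f: "f \<in> Cc X" by (simp add: Cc_ring_def)
    show "\<exists>g\<in>carrier (Cc_ring X). g \<oplus>\<^bsub>Cc_ring X\<^esub> f = \<zero>\<^bsub>Cc_ring X\<^esub>"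
      using Cc_closed(3)[OF f f]
      by (intro bexI[of _ "\<lambda>x\<in>topspace X. - f x"]) (auto simp: Cc_ring_def fun_eq_iff)
    show "\<zero>\<^bsub>Cc_ring X\<^esub> \<oplus>\<^bsub>Cc_ring X\<^esub> f = f"
      using ext[OF f] by (auto simp: Cc_ring_def fun_eq_iff extensional_def)
  qed (auto simp: Cc_ring_def Cc_closed Cc_const fun_eq_iff)
  show "comm_monoid (Cc_ring X)"
  proof (rule comm_monoidI)
    fix f assume "f \<in> carrier (Cc_ring X)"
    then have f: "f \<in> Cc X" by (simp add: Cc_ring_def)
    show "\<one>\<^bsub>Cc_ring X\<^esub> \<otimes>\<^bsub>Cc_ring X\<^esub> f = f"
      using ext[OF f] by (auto simp: Cc_ring_def fun_eq_iff extensional_def)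
  qed (auto simp: Cc_ring_def Cc_closed Cc_const fun_eq_iff)
qed (auto simp: Cc_ring_def fun_eq_iff algebra_simps)

end

(* Every f in C_c(X) is a quotient of two bounded members g = f/(1+|f|) and u = 1/(1+|f|) with u
   vanishing nowhere. Regularity gives x in A with u = u x u, so x = 1/u and f = g x lies in A. *)
theory Submission
  imports Defs
begin

text \<open>Regularity makes \<open>A\<close> closed under inverting nowhere vanishing members: from
  \<open>u = u * v * u\<close> with \<open>v\<close> in \<open>A\<close>, cancelling
  \<open>u x\<close> at each point shows that \<open>v\<close> is the reciprocal of
  \<open>u\<close>. So \<open>A\<close> contains every quotient of bounded members with such a
  denominator, and these quotients exhaust \<open>Cc X\<close>.\<close>

text \<open>Boundedness comes from \<open>h\<close> alone, so \<open>f\<close> may be unbounded; the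
  range stays countable as the image of a countable set.\<close>

lemma Cc_star_compose:
  assumes "f \<in> Cc X" "continuous_on UNIV h" "bounded (range h)"
  shows "(\<lambda>x\<in>topspace X. h (f x)) \<in> Cc_star X"
proof -
  have "continuous_map X euclideanreal (\<lambda>x. h (f x))"
    using assms(1,2) continuous_map_compose[of X euclideanreal f euclideanreal h]
    by (simp add: Cc_def o_def)
  moreover have "countable ((\<lambda>x. h (f x)) ` topspace X)"
    using assms(1) countable_image[of "f ` topspace X" h] by (simp add: Cc_def image_image)
  moreover have "bounded ((\<lambda>x\<in>topspace X. h (f x)) ` topspace X)"
    by (rule bounded_subset[OF assms(3)]) auto
  ultimately show ?thesis
    by (simp add: Cc_star_def Cc_restrict_iff)
qed

theorem theorem3p16:
  fixes X :: "'a topology" and A :: "('a \<Rightarrow> real) set"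
  assumes "zero_dimensional_space X"
    and "Hausdorff_space X"
    and "subring A (Cc_ring X)"
    and "Cc_star X \<subseteq> A"
    and "A \<subseteq> Cc X"
    and "von_neumann_regular (Cc_ring X \<lparr>carrier := A\<rparr>)"
  shows "A = Cc X"
proof
  show "Cc X \<subseteq> A"
  proof
    fix f assume f: "f \<in> Cc X"
    \<comment> \<open>The denominator is at least 1, so both quotients are continuous in the value
      of \<open>f\<close> and bounded by 1 in absolute value.\<close>
    define g u where "g = (\<lambda>x\<in>topspace X. f x / (1 + \<bar>f x\<bar>))"
      and "u = (\<lambda>x\<in>topspace X. 1 / (1 + \<bar>f x\<bar>))"
    have "bounded (range (\<lambda>t::real. t / (1 + \<bar>t\<bar>)))" "bounded (range (\<lambda>t::real. 1 / (1 + \<bar>t\<bar>)))"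
      by (auto simp: bounded_iff divide_le_eq intro!: exI[of _ 1])
    moreover have "continuous_on UNIV (\<lambda>t::real. t / (1 + \<bar>t\<bar>))"
      "continuous_on UNIV (\<lambda>t::real. 1 / (1 + \<bar>t\<bar>))"
      by (auto intro!: continuous_intros simp: add_nonneg_eq_0_iff)
    ultimately have "g \<in> A" "u \<in> A"
      using Cc_star_compose[OF f] assms(4) unfolding g_def u_def by blast+
    \<comment> \<open>Replacing the carrier leaves multiplication pointwise, and the witness of
      regularity lies in \<open>A\<close> itself.\<close>
    then obtain v where "v \<in> A" and v: "u = (\<lambda>x\<in>topspace X. u x * v x * u x)"
      using assms(6) by (fastforce simp: von_neumann_regular_def Cc_ring_def cong: restrict_cong)
    have "f x = g x * v x" if "x \<in> topspace X" for x
    proof -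
      have "u x = u x * v x * u x"
        using fun_cong[OF v, of x] that by (simp only: restrict_apply if_True)
      moreover have "u x \<noteq> 0" using that by (simp add: u_def add_nonneg_eq_0_iff)
      ultimately have "u x * v x = 1" by simp
      moreover have "g x = f x * u x" using that by (simp add: g_def u_def)
      ultimately show ?thesis by simp
    qed
    \<comment> \<open>Off \<open>topspace X\<close> both sides are \<open>undefined\<close>, so
      pointwise agreement on the space suffices.\<close>
    then have "f = g \<otimes>\<^bsub>Cc_ring X\<^esub> v"
      using f by (auto simp: Cc_ring_def Cc_def extensional_def)
    then show "f \<in> A"
      using subringE(6)[OF assms(3) \<open>g \<in> A\<close> \<open>v \<in> A\<close>] by simp
  qed
qed (fact assms(5))

end
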